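(* Let $n$ be a nonnegative integer and let $k$ be an integer with $0\le k\le n-2$. Then there is a weight preserving bijection $$\phi_{n,k}\colon\; P_{n,k}\,\cup\,\big(\{2n-1\}\times P_{n-1,k-1}\big)\;\longrightarrow\; P_{n-1,k-1}\,\cup\,\big(\{2n-3\}\times P_{n-2,k}\big),$$ where the unions are disjoint unions; that is, $\phi_{n,k}$ is a bijection with $w(\phi_{n,k}(\alpha))=w(\alpha)$ for every $\alpha$ in its domain.
   Context: A partition is a nonincreasing finite sequence of positive integers $\lambda=(\lambda_1,\dots,\lambda_\ell)$; $|\lambda|$ is the sum of its parts, $\ell(\lambda)$ the number of its parts, and $\emptyset$ the partition with no parts. Let $D$ be the set of partitions with pairwise distinct parts and $E$ the set of partitions all of whose parts are even (both contain $\emptyset$). For integers $0\le k\le n$, $P_{n,k}$ is the set of triples $(\tau,\lambda,\mu)$ such that: - $\tau=(n-k-1,n-k-2,\dots,2,1,0)$, the fixed sequence of length $n-k$, whose last entry $0$ is counted as a part (so $\tau=(0)$ if $k=n-1$, and $\tau=\emptyset$ if $k=n$; the sequence $(0)$ and the empty sequence $\emptyset$ are considered different); - $\lambda\in D$ and every part $\lambda_i$ of $\lambda$ satisfies $n-k+1\le\lambda_i\le n+k$; - $\mu\in E$ and every part of $\mu$ is at most $2k$. In particular $P_{n,0}=\{((n-1,\dots,1,0),\emptyset,\emptyset)\}$. For $k>n$ or $k<0$, $P_{n,k}=\emptyset$. The weight $w$ takes values in signed powers of the indeterminate $q$: for a triple, $w(\tau,\lambda,\mu)=(-1)^{\ell(\lambda)}q^{|\tau|+|\lambda|+|\mu|}$,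 where $|\tau|$ is the sum of the entries of $\tau$; and for an integer $m\in\{2n-1,2n-3\}$ paired with a triple, $w(m,(\tau,\lambda,\mu))=q^{m}(-1)^{\ell(\lambda)}q^{|\tau|+|\lambda|+|\mu|}$. *)

theory Defs
  imports "HOL-Computational_Algebra.Formal_Laurent_Series"
begin

definition partitions :: "nat list set" where
  "partitions = {xs. sorted_wrt (\<ge>) xs \<and> (\<forall>x\<in>set xs. 0 < x)}"

definition D :: "nat list set" where
  "D = {xs \<in> partitions. distinct xs}"

definition E :: "nat list set" where
  "E = {xs \<in> partitions. \<forall>x\<in>set xs. even x}"

text \<open>The sequence \<open>(m - 1, \<dots>, 1, 0)\<close>: its last entry \<open>0\<close> is a genuine entry, so it is not in
  general an element of \<^const>\<open>partitions\<close>, and \<open>staircase 1 = [0]\<close> differs from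
  \<open>staircase 0 = []\<close>.\<close>

definition staircase :: "nat \<Rightarrow> nat list" where
  "staircase m = rev [0..<m]"

type_synonym triple = "nat list \<times> nat list \<times> nat list"

text \<open>The indices are integers because \<open>P\<close> is also used with second index \<open>-1\<close>, where it is
  empty.\<close>

definition P :: "int \<Rightarrow> int \<Rightarrow> triple set" where
  "P n k = {(\<tau>, la, \<mu>). 0 \<le> k \<and> k \<le> n \<and>
     \<tau> = staircase (nat (n - k)) \<and>
     la \<in> D \<and> (\<forall>x\<in>set la. n - k + 1 \<le> int x \<and> int x \<le> n + k) \<and>
     \<mu> \<in> E \<and> (\<forall>x\<in>set \<mu>. int x \<le> 2 * k)}"

text \<open>Weights are elements of the ring of formal Laurent series over the integers; the
  indeterminate \<open>q\<close> is \<^const>\<open>fls_X\<close>, and \<open>fls_X_intpow i\<close> is \<open>q\<close> to the integer power \<open>i\<close>.\<close>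

fun weight :: "triple \<Rightarrow> int fls" where
  "weight (\<tau>, la, \<mu>) =
     (-1) ^ length la * fls_X_intpow (int (sum_list \<tau> + sum_list la + sum_list \<mu>))"

fun weight_pair :: "int \<times> triple \<Rightarrow> int fls" where
  "weight_pair (m, t) = fls_X_intpow m * weight t"

fun w :: "triple + int \<times> triple \<Rightarrow> int fls" where
  "w (Inl t) = weight t"
| "w (Inr p) = weight_pair p"

end

theory Submission
  imports Defs
begin

text \<open>For \<open>k \<ge> 1\<close> let \<open>\<lambda>\<close> be a partition into distinct parts in \<open>[n - k + 1, n + k - 2]\<close>. An element
  of \<open>P n k\<close> is obtained from such a \<open>\<lambda>\<close> by possibly prepending \<open>n + k\<close> and \<open>n + k - 1\<close>, an element
  of \<open>P (n - 2) k\<close> by possibly appending \<open>n - k\<close> and \<open>n - k - 1\<close>, and an element of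
  \<open>P (n - 1) (k - 1)\<close> is \<open>\<lambda>\<close> itself with no part \<open>2k\<close> in \<open>\<mu>\<close>. Exchanging one prepended part for the
  corresponding appended one lowers the weight by \<open>2k = (2n - 3) - (n - k - 1) - (n - k - 2)\<close>, which
  the factor \<open>q\<^bsup>2n-3\<^esup>\<close> and the two entries missing from the shorter staircase make up for. The
  remaining cases are balanced by adding or removing one part \<open>2k\<close> of \<open>\<mu>\<close>, and by the factor
  \<open>q\<^bsup>2n-1\<^esup>\<close> when both parts are appended.\<close>

section \<open>Partitions with bounded parts, split at an extreme part\<close>

definition distinct_parts :: "nat \<Rightarrow> nat \<Rightarrow> nat list set" where
  "distinct_parts a b = {la \<in> D. set la \<subseteq> {a..b}}"

definition even_parts :: "nat \<Rightarrow> nat list set" where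
  "even_parts b = {\<mu> \<in> E. set \<mu> \<subseteq> {..b}}"

text \<open>Indexing by the staircase length \<open>m\<close>, which is n - k, makes all bounds
  natural numbers without truncated subtraction.\<close>

lemma P_eq:
  "P (int m + int k) (int k) = {staircase m} \<times> distinct_parts (m + 1) (m + 2 * k) \<times> even_parts (2 * k)"
proof -
  have "int m + 1 \<le> int x \<longleftrightarrow> m + 1 \<le> x"
    and "int x \<le> int m + int k + int k \<longleftrightarrow> x \<le> m + 2 * k"
    and "int x \<le> 2 * int k \<longleftrightarrow> x \<le> 2 * k" for x by linarith+
  then show ?thesis
    by (auto simp: P_def distinct_parts_def even_parts_def)
qed

lemma D_Cons_iff: "x # la \<in> D \<longleftrightarrow> la \<in> D \<and> 0 < x \<and> (\<forall>y\<in>set la. y < x)"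
  by (auto simp: D_def partitions_def le_less)

lemma D_snoc_iff: "la @ [x] \<in> D \<longleftrightarrow> la \<in> D \<and> 0 < x \<and> (\<forall>y\<in>set la. x < y)"
  by (auto simp: D_def partitions_def sorted_wrt_append le_less)

lemma E_Cons_iff: "x # \<mu> \<in> E \<longleftrightarrow> \<mu> \<in> E \<and> 0 < x \<and> even x \<and> (\<forall>y\<in>set \<mu>. y \<le> x)"
  by (auto simp: E_def partitions_def)

text \<open>Parts decrease strictly, so \<open>Suc b\<close> can occur only as the head, with every
  other part below it.\<close>

lemma distinct_parts_Suc_upper:
  assumes "a \<le> Suc b"
  shows "distinct_parts a (Suc b) = distinct_parts a b \<union> (#) (Suc b) ` distinct_parts a b"
proof (intro equalityI subsetI)
  fix la assume la: "la \<in> distinct_parts a (Suc b)"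
  show "la \<in> distinct_parts a b \<union> (#) (Suc b) ` distinct_parts a b"
  proof (cases la)
    case Nil
    then show ?thesis using la by (auto simp: distinct_parts_def)
  next
    case (Cons x xs)
    then have xs: "xs \<in> D" "la \<in> D" "\<forall>y\<in>set xs. a \<le> y \<and> y < x" "a \<le> x" "x \<le> Suc b"
      using la by (auto simp: distinct_parts_def D_Cons_iff)
    show ?thesis
    proof (cases "x = Suc b")
      case True
      then have "xs \<in> distinct_parts a b" using xs by (auto simp: distinct_parts_def)
      then show ?thesis using True Cons by blast
    next
      case False
      then have "x \<le> b" using xs by simp
      then have "la \<in> distinct_parts a b" using xs Cons by (auto simp: distinct_parts_def)
      then show ?thesis by blast
    qed
  qed
qed (use assms in \<open>auto simp: distinct_parts_def D_Cons_iff le_Suc_eq less_Suc_eq_le subset_iff\<close>)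

lemma distinct_parts_Suc_lower:
  assumes "0 < a" "a \<le> b"
  shows "distinct_parts a b = distinct_parts (Suc a) b \<union> (\<lambda>la. la @ [a]) ` distinct_parts (Suc a) b"
proof (intro equalityI subsetI)
  fix la assume la: "la \<in> distinct_parts a b"
  show "la \<in> distinct_parts (Suc a) b \<union> (\<lambda>la. la @ [a]) ` distinct_parts (Suc a) b"
  proof (cases la rule: rev_cases)
    case Nil
    then show ?thesis using la by (auto simp: distinct_parts_def)
  next
    case (snoc xs x)
    then have xs: "xs \<in> D" "la \<in> D" "\<forall>y\<in>set xs. x < y \<and> y \<le> b" "a \<le> x" "x \<le> b"
      using la by (auto simp: distinct_parts_def D_snoc_iff)
    show ?thesis
    proof (cases "x = a")
      case True
      then have "xs \<in> distinct_parts (Suc a) b" using xs by (auto simp: distinct_parts_def)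
      then show ?thesis using True snoc by blast
    next
      case False
      then have "Suc a \<le> x" using xs by simp
      then have "la \<in> distinct_parts (Suc a) b" using xs snoc by (auto simp: distinct_parts_def)
      then show ?thesis by blast
    qed
  qed
qed (use assms in \<open>auto simp: distinct_parts_def D_snoc_iff Suc_le_eq subset_iff\<close>)

text \<open>Even parts may repeat: deleting one leading \<open>2 * Suc k\<close> leaves the bound
  unchanged, hence the same set recurs on the right.\<close>

lemma even_parts_Suc:
  "even_parts (2 * Suc k) = even_parts (2 * k) \<union> (#) (2 * Suc k) ` even_parts (2 * Suc k)"
proof (intro equalityI subsetI)
  fix \<mu> assume \<mu>: "\<mu> \<in> even_parts (2 * Suc k)"
  show "\<mu> \<in> even_parts (2 * k) \<union> (#) (2 * Suc k) ` even_parts (2 * Suc k)"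
  proof (cases \<mu>)
    case Nil
    then show ?thesis using \<mu> by (auto simp: even_parts_def)
  next
    case (Cons x xs)
    then have xs: "xs \<in> E" "\<mu> \<in> E" "\<forall>y\<in>set xs. y \<le> x" "even x" "x \<le> 2 * Suc k"
      using \<mu> by (auto simp: even_parts_def E_Cons_iff)
    show ?thesis
    proof (cases "x = 2 * Suc k")
      case True
      then have "xs \<in> even_parts (2 * Suc k)" using xs by (auto simp: even_parts_def)
      then show ?thesis using True Cons by blast
    next
      case False
      then have "x \<le> 2 * k" using xs by presburger
      then have "\<mu> \<in> even_parts (2 * k)" using xs Cons by (auto simp: even_parts_def)
      then show ?thesis by blast
    qed
  qed
qed (auto simp: even_parts_def E_Cons_iff subset_iff)

section \<open>Common codes for domain and codomain\<close>

datatype code =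
    Plain "nat list" "nat list" | Even "nat list" "nat list"
  | Lower "nat list" "nat list" | Upper "nat list" "nat list"
  | Both "nat list" "nat list" | Extra "nat list" "nat list"

text \<open>In use, \<open>L\<close> has the distinct parts in [n - k + 1, n + k - 2], and
  \<open>M\<close>, \<open>M'\<close> the even parts up to 2k and 2k - 2. \<open>Plain\<close> and
  \<open>Extra\<close> draw from \<open>M'\<close>: a further part 2k is accounted for by
  \<open>Even\<close> in \<open>source\<close> and by \<open>Both\<close> in
  \<open>target\<close>.\<close>

definition codes :: "nat list set \<Rightarrow> nat list set \<Rightarrow> nat list set \<Rightarrow> code set" where
  "codes L M M' = (\<Union>la\<in>L. (\<Union>\<mu>\<in>M'. {Plain la \<mu>, Extra la \<mu>}) \<union>
     (\<Union>\<mu>\<in>M. {Even la \<mu>, Lower la \<mu>, Upper la \<mu>, Both la \<mu>}))"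

text \<open>Throughout, \<open>m = n - k - 2\<close> and \<open>j = k - 1\<close>, so that no subtraction occurs.\<close>

fun source :: "nat \<Rightarrow> nat \<Rightarrow> code \<Rightarrow> triple + int \<times> triple" where
  "source m j (Plain la \<mu>) = Inl (staircase (m + 2), la, \<mu>)"
| "source m j (Even la \<mu>) = Inl (staircase (m + 2), la, 2 * Suc j # \<mu>)"
| "source m j (Lower la \<mu>) = Inl (staircase (m + 2), (m + 2 * j + 3) # la, \<mu>)"
| "source m j (Upper la \<mu>) = Inl (staircase (m + 2), (m + 2 * j + 4) # la, \<mu>)"
| "source m j (Both la \<mu>) = Inl (staircase (m + 2), (m + 2 * j + 4) # (m + 2 * j + 3) # la, \<mu>)"
| "source m j (Extra la \<mu>) = Inr (2 * int (m + j + 3) - 1, staircase (m + 2), la, \<mu>)"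

text \<open>The appended \<open>m + 2\<close> and \<open>m + 1\<close> are n - k and n - k - 1; they
  answer to the prepended n + k and n + k - 1 of \<open>source\<close>.\<close>

fun target :: "nat \<Rightarrow> nat \<Rightarrow> code \<Rightarrow> triple + int \<times> triple" where
  "target m j (Plain la \<mu>) = Inl (staircase (m + 2), la, \<mu>)"
| "target m j (Even la \<mu>) = Inr (2 * int (m + j + 3) - 3, staircase m, la, \<mu>)"
| "target m j (Lower la \<mu>) = Inr (2 * int (m + j + 3) - 3, staircase m, la @ [m + 1], \<mu>)"
| "target m j (Upper la \<mu>) = Inr (2 * int (m + j + 3) - 3, staircase m, la @ [m + 2], \<mu>)"
| "target m j (Both la \<mu>) =
     Inr (2 * int (m + j + 3) - 3, staircase m, la @ [m + 2, m + 1], 2 * Suc j # \<mu>)"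
| "target m j (Extra la \<mu>) = Inr (2 * int (m + j + 3) - 3, staircase m, la @ [m + 2, m + 1], \<mu>)"

lemma sum_list_staircase_Suc_Suc: "sum_list (staircase (Suc (Suc m))) = sum_list (staircase m) + 2 * m + 1"
  by (simp add: staircase_def)

lemma w_Inr:
  "w (Inr (i, \<tau>, la, \<mu>)) =
    (-1) ^ length la * fls_X_intpow (i + int (sum_list \<tau> + sum_list la + sum_list \<mu>))"
  unfolding w.simps weight_pair.simps weight.simps
  by (metis mult.left_commute fls_X_intpow_times_fls_X_intpow)

text \<open>Signs agree because the lengths of the distinct partitions are equal, except for
  \<open>Extra\<close>, where they differ by two.\<close>

lemma w_target: "w (target m j c) = w (source m j c)"
  by (cases c) (simp_all add: w_Inr sum_list_staircase_Suc_Suc algebra_simps del: w.simps(2))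

lemma source_image:
  assumes M: "M = M' \<union> (#) (2 * Suc j) ` M"
  shows "source m j ` codes L M M' =
    ({staircase (m + 2)} \<times> (L \<union> (#) (m + 2 * j + 3) ` L \<union>
       (#) (m + 2 * j + 4) ` (L \<union> (#) (m + 2 * j + 3) ` L)) \<times> M)
    <+> ({2 * int (m + j + 3) - 1} \<times> {staircase (m + 2)} \<times> L \<times> M')" (is "_ = ?R")
proof (intro equalityI subsetI)
  have M': "\<mu> \<in> M' \<Longrightarrow> \<mu> \<in> M" "\<mu> \<in> M \<Longrightarrow> 2 * Suc j # \<mu> \<in> M" for \<mu>
    using M by blast+
  fix z assume "z \<in> source m j ` codes L M M'"
  then show "z \<in> ?R" using M' by (auto simp: codes_def)
next
  fix z assume "z \<in> ?R"
  then consider la \<mu> where "z = source m j (Extra la \<mu>)" "la \<in> L" "\<mu> \<in> M'"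
    | la \<mu> where "z = Inl (staircase (m + 2), la, \<mu>)" "la \<in> L" "\<mu> \<in> M"
    | la \<mu> where "z = source m j (Lower la \<mu>) \<or> z = source m j (Upper la \<mu>) \<or> z = source m j (Both la \<mu>)"
        "la \<in> L" "\<mu> \<in> M"
    unfolding source.simps by blast
  then have "\<exists>c \<in> codes L M M'. z = source m j c"
  proof cases
    \<comment> \<open>With nothing prepended, the code is \<open>Plain\<close> or
      \<open>Even\<close>; the splitting of \<open>M\<close> decides which.\<close>
    case (2 la \<mu>)
    from \<open>\<mu> \<in> M\<close> M consider "\<mu> \<in> M'" | \<mu>' where "\<mu>' \<in> M" "\<mu> = 2 * Suc j # \<mu>'" by blast
    then show ?thesis
    proof cases
      case 1
      then show ?thesis using 2 by (intro bexI[of _ "Plain la \<mu>"]) (auto simp: codes_def)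
    next
      case (2 \<mu>')
      then show ?thesis using \<open>la \<in> L\<close> \<open>z = _\<close>
        by (intro bexI[of _ "Even la \<mu>'"]) (auto simp: codes_def)
    qed
  qed (unfold codes_def, blast+)
  then show "z \<in> source m j ` codes L M M'" by blast
qed

lemma target_image:
  assumes M: "M = M' \<union> (#) (2 * Suc j) ` M"
  shows "target m j ` codes L M M' =
    ({staircase (m + 2)} \<times> L \<times> M')
    <+> ({2 * int (m + j + 3) - 3} \<times> {staircase m} \<times>
      ((L \<union> (\<lambda>la. la @ [m + 2]) ` L) \<union> (\<lambda>la. la @ [m + 1]) ` (L \<union> (\<lambda>la. la @ [m + 2]) ` L)) \<times> M)"
    (is "_ = ?R")
proof (intro equalityI subsetI)
  have M': "\<mu> \<in> M' \<Longrightarrow> \<mu> \<in> M" "\<mu> \<in> M \<Longrightarrow> 2 * Suc j # \<mu> \<in> M" for \<mu>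
    using M by blast+
  fix z assume "z \<in> target m j ` codes L M M'"
  then show "z \<in> ?R" using M' by (auto simp: codes_def image_image image_Un)
next
  have append2: "la @ [x, y] = (la @ [x]) @ [y]" for la :: "nat list" and x y by simp
  fix z assume "z \<in> ?R"
  then consider la \<mu> where "z = target m j (Plain la \<mu>)" "la \<in> L" "\<mu> \<in> M'"
    | la \<mu> where "z = Inr (2 * int (m + j + 3) - 3, staircase m, la @ [m + 2, m + 1], \<mu>)"
        "la \<in> L" "\<mu> \<in> M"
    | la \<mu> where "z = target m j (Even la \<mu>) \<or> z = target m j (Lower la \<mu>) \<or> z = target m j (Upper la \<mu>)"
        "la \<in> L" "\<mu> \<in> M"
    unfolding target.simps append2 by blast
  then have "\<exists>c \<in> codes L M M'. z = target m j c"
  proof cases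
    \<comment> \<open>On this side the ambiguity arises when both parts are appended:
      \<open>Extra\<close> or \<open>Both\<close>.\<close>
    case (2 la \<mu>)
    from \<open>\<mu> \<in> M\<close> M consider "\<mu> \<in> M'" | \<mu>' where "\<mu>' \<in> M" "\<mu> = 2 * Suc j # \<mu>'" by blast
    then show ?thesis
    proof cases
      case 1
      then show ?thesis using 2 by (intro bexI[of _ "Extra la \<mu>"]) (auto simp: codes_def)
    next
      case (2 \<mu>')
      then show ?thesis using \<open>la \<in> L\<close> \<open>z = _\<close>
        by (intro bexI[of _ "Both la \<mu>'"]) (auto simp: codes_def)
    qed
  qed (unfold codes_def, blast+)
  then show "z \<in> target m j ` codes L M M'" by blast
qed

lemma snoc_eq_append_two_iff: "xs @ [x] = ys @ [y, z] \<longleftrightarrow> xs = ys @ [y] \<and> x = z"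
  using append1_eq_conv[of xs x "ys @ [y]" z] by simp

text \<open>The part 2k separates \<open>Even\<close> from \<open>Plain\<close>, a new head
  separates the prepended cases from those, and \<open>Inr\<close> separates
  \<open>Extra\<close>.\<close>

lemma inj_on_source:
  assumes "\<And>\<mu>. 2 * Suc j # \<mu> \<notin> M'"
    and "\<And>la. (m + 2 * j + 3) # la \<notin> L" "\<And>la. (m + 2 * j + 4) # la \<notin> L"
  shows "inj_on (source m j) (codes L M M')"
proof (rule inj_onI)
  fix c c' assume "c \<in> codes L M M'" "c' \<in> codes L M M'" "source m j c = source m j c'"
  then show "c = c'"
    using assms by (cases c; cases c') (auto simp: codes_def)
qed

text \<open>The part 2k now separates \<open>Both\<close> from \<open>Extra\<close>. Excluding
  \<open>la @ [m + 2]\<close> from \<open>L\<close> also keeps \<open>Lower\<close> apart from these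
  two, which share its last entry.\<close>

lemma inj_on_target:
  assumes "\<And>\<mu>. 2 * Suc j # \<mu> \<notin> M'"
    and "\<And>la. la @ [m + 1] \<notin> L" "\<And>la. la @ [m + 2] \<notin> L"
    and "\<And>la. la @ [m + 2, m + 1] \<notin> L"
  shows "inj_on (target m j) (codes L M M')"
proof (rule inj_onI)
  fix c c' assume "c \<in> codes L M M'" "c' \<in> codes L M M'" "target m j c = target m j c'"
  then show "c = c'"
    using assms by (cases c; cases c') (auto simp: codes_def snoc_eq_append_two_iff eq_commute[of "_ @ [_, _]" "_ @ [_]"])
qed

section \<open>Assembling the bijection\<close>

lemma weight_preserving_bij_step:
  fixes m j :: nat
  defines "n \<equiv> int (m + j + 3)" and "k \<equiv> int (Suc j)"
  shows "\<exists>\<phi>. bij_betw \<phi>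
      (P n k <+> ({2 * n - 1} \<times> P (n - 1) (k - 1)))
      (P (n - 1) (k - 1) <+> ({2 * n - 3} \<times> P (n - 2) k)) \<and>
    (\<forall>\<alpha> \<in> P n k <+> ({2 * n - 1} \<times> P (n - 1) (k - 1)). w (\<phi> \<alpha>) = w \<alpha>)"
proof -
  define L where "L = distinct_parts (m + 3) (m + 2 * j + 2)"
  define M where "M = even_parts (2 * Suc j)"
  define M' where "M' = even_parts (2 * j)"
  have n: "n = int (m + 2) + int (Suc j)" "n - 1 = int (m + 2) + int j" "n - 2 = int m + int (Suc j)"
    and k: "k - 1 = int j"
    by (simp_all add: n_def k_def)
  have M: "M = M' \<union> (#) (2 * Suc j) ` M"
    unfolding M_def M'_def by (rule even_parts_Suc)
  have 1: "P (n - 1) (k - 1) = {staircase (m + 2)} \<times> L \<times> M'"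
    unfolding n(2) k P_eq L_def M'_def by (simp add: algebra_simps numeral_eq_Suc)
  \<comment> \<open>Peel off n + k, then n + k - 1, from the top of the interval.\<close>
  have "distinct_parts (m + 3) (m + 2 * j + 4) = L \<union> (#) (m + 2 * j + 3) ` L \<union>
       (#) (m + 2 * j + 4) ` (L \<union> (#) (m + 2 * j + 3) ` L)"
    using distinct_parts_Suc_upper[of "m + 3" "m + 2 * j + 2"]
      distinct_parts_Suc_upper[of "m + 3" "m + 2 * j + 3"]
    unfolding L_def by (simp add: numeral_eq_Suc)
  then have 2: "P n k = {staircase (m + 2)} \<times> (L \<union> (#) (m + 2 * j + 3) ` L \<union>
       (#) (m + 2 * j + 4) ` (L \<union> (#) (m + 2 * j + 3) ` L)) \<times> M"
    unfolding n(1) k_def P_eq M_def by (simp add: algebra_simps numeral_eq_Suc)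
  \<comment> \<open>Peel off n - k - 1, then n - k, from the bottom.\<close>
  have "distinct_parts (m + 1) (m + 2 * j + 2) =
      (L \<union> (\<lambda>la. la @ [m + 2]) ` L) \<union> (\<lambda>la. la @ [m + 1]) ` (L \<union> (\<lambda>la. la @ [m + 2]) ` L)"
    using distinct_parts_Suc_lower[of "m + 1" "m + 2 * j + 2"]
      distinct_parts_Suc_lower[of "m + 2" "m + 2 * j + 2"]
    unfolding L_def by (simp add: numeral_eq_Suc)
  then have 3: "P (n - 2) k = {staircase m} \<times>
      ((L \<union> (\<lambda>la. la @ [m + 2]) ` L) \<union> (\<lambda>la. la @ [m + 1]) ` (L \<union> (\<lambda>la. la @ [m + 2]) ` L)) \<times> M"
    unfolding n(3) k_def P_eq M_def by (simp add: algebra_simps numeral_eq_Suc)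
  let ?f = "source m j" and ?g = "target m j" and ?C = "codes L M M'"
  have f: "?f ` ?C = P n k <+> ({2 * n - 1} \<times> P (n - 1) (k - 1))"
    by (simp only: 1 2 source_image[OF M] n_def[symmetric])
  have g: "?g ` ?C = P (n - 1) (k - 1) <+> ({2 * n - 3} \<times> P (n - 2) k)"
    by (simp only: 1 3 target_image[OF M] n_def[symmetric])
  have bf: "bij_betw ?f ?C (P n k <+> ({2 * n - 1} \<times> P (n - 1) (k - 1)))"
    unfolding f[symmetric]
    by (intro inj_on_imp_bij_betw inj_on_source) (auto simp: L_def M'_def distinct_parts_def even_parts_def)
  have bg: "bij_betw ?g ?C (P (n - 1) (k - 1) <+> ({2 * n - 3} \<times> P (n - 2) k))"
    unfolding g[symmetric]
    by (intro inj_on_imp_bij_betw inj_on_target) (auto simp: L_def M'_def distinct_parts_def even_parts_def)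
  show ?thesis
  proof (intro exI conjI ballI)
    \<comment> \<open>Decode an element by inverting \<open>source\<close> on the codes, then encode
      it by \<open>target\<close>.\<close>
    show "bij_betw (?g \<circ> inv_into ?C ?f) (P n k <+> ({2 * n - 1} \<times> P (n - 1) (k - 1)))
      (P (n - 1) (k - 1) <+> ({2 * n - 3} \<times> P (n - 2) k))"
      by (rule bij_betw_trans[OF bij_betw_inv_into[OF bf] bg])
    fix \<alpha> assume "\<alpha> \<in> P n k <+> ({2 * n - 1} \<times> P (n - 1) (k - 1))"
    then show "w ((?g \<circ> inv_into ?C ?f) \<alpha>) = w \<alpha>"
      unfolding f[symmetric] by (simp add: w_target f_inv_into_f)
  qed
qed

lemma P_0:
  assumes "0 \<le> n"
  shows "P n 0 = {(staircase (nat n), [], [])}"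
proof -
  have "distinct_parts (nat n + 1) (nat n) = {[]}"
    by (auto simp: distinct_parts_def D_def partitions_def)
  moreover have "\<mu> \<in> even_parts 0 \<longleftrightarrow> \<mu> = []" for \<mu>
    by (cases \<mu>) (auto simp: even_parts_def E_Cons_iff, simp add: E_def partitions_def)
  then have "even_parts 0 = {[]}" by blast
  ultimately show ?thesis
    using P_eq[of "nat n" 0] assms by simp
qed

theorem theorem3p1:
  fixes n k :: int
  assumes "0 \<le> n" and "0 \<le> k" and "k \<le> n - 2"
  shows "\<exists>\<phi> :: triple + int \<times> triple \<Rightarrow> triple + int \<times> triple.
    bij_betw \<phi>
      (P n k <+> ({2 * n - 1} \<times> P (n - 1) (k - 1)))
      (P (n - 1) (k - 1) <+> ({2 * n - 3} \<times> P (n - 2) k)) \<and>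
    (\<forall>\<alpha> \<in> P n k <+> ({2 * n - 1} \<times> P (n - 1) (k - 1)). w (\<phi> \<alpha>) = w \<alpha>)"
proof (cases "k = 0")
  case True
  define m where "m = nat (n - 2)"
  have n: "n = int (m + 2)"
    using assms by (simp add: m_def)
  have *: "P n k = {(staircase (m + 2), [], [])}" "P (n - 2) k = {(staircase m, [], [])}"
    using assms P_0[of n] P_0[of "n - 2"] by (simp_all add: True n nat_add_distrib)
  \<comment> \<open>The index -1 gives an empty set, so both sides are singletons and a constant map
    suffices; the staircase sums differ by 2n - 3.\<close>
  have "P (n - 1) (k - 1) = {}"
    by (simp add: P_def True)
  with * show ?thesis
    by (intro exI[of _ "\<lambda>_. Inr (2 * n - 3, staircase m, [], [])"])
      (auto simp: bij_betw_def inj_on_def n w_Inr sum_list_staircase_Suc_Suc algebra_simps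
        simp del: w.simps(2))
next
  case False
  \<comment> \<open>Neither \<open>nat\<close> truncates, since k is at least 1 and at most n -
    2.\<close>
  define m j where "m = nat (n - k - 2)" and "j = nat (k - 1)"
  have "n = int (m + j + 3)" "k = int (Suc j)"
    using assms False by (simp_all add: m_def j_def)
  then show ?thesis
    using weight_preserving_bij_step[of m j] by simp
qed

end
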